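(* Let $(X,\mu)$ be a non-atomic probability space, let $\mathcal{T}$ be a tree on $X$ with associated maximal operator $\mathcal{M}_{\mathcal{T}}$, let $p>1$, and let $f,F,L,k$ be real numbers with $0<f^p\le F$, $L\ge f$ and $k\in(0,1]$. Then $$B_p^{\mathcal{T}}(f,F,L,k)=\sup\left\{B_p^{\mathcal{T}}(f,F,k_1)+L^p(k-k_1):\ k_1\in(0,k]\right\}.$$
   Context: Let $(X,\mu)$ be a non-atomic probability space. A set $\mathcal{T}$ of measurable subsets of $X$ is called a tree if: (i) $X\in\mathcal{T}$ and $\mu(I)>0$ for every $I\in\mathcal{T}$; (ii) for every $I\in\mathcal{T}$ there corresponds a finite or countable subset $C(I)\subseteq\mathcal{T}$ containing at least two elements, whose elements are pairwise disjoint subsets of $I$ with $I=\bigcup C(I)$; (iii) $\mathcal{T}=\bigcup_{m\ge 0}\mathcal{T}_{(m)}$, where $\mathcal{T}_{(0)}=\{X\}$ and $\mathcal{T}_{(m+1)}=\bigcup_{I\in\mathcal{T}_{(m)}}C(I)$; (iv) $\lim_{m\to\infty}\sup_{I\in\mathcal{T}_{(m)}}\mu(I)=0$; (v) $\mathcal{T}$ differentiates $L^1(X,\mu)$, i.e. for every $\phi\in L^1(X,\mu)$, $\lim_{x\in I\in\mathcal{T},\,\mu(I)\to 0}\frac{1}{\mu(I)}\int_I\phi\,d\mu=\phi(x)$ for $\mu$-almost every $x\in X$. The associated maximal operator is $\mathcal{M}_{\mathcal{T}}\phi(x)=\sup\left\{\frac{1}{\mu(I)}\int_I|\phi|\,d\mu:\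 x\in I\in\mathcal{T}\right\}$ for $\phi\in L^1(X,\mu)$, $x\in X$. For $p>1$, $0<f^p\le F$, $L\ge f$, $k\in(0,1]$, the Bellman function of four variables is $$B_p^{\mathcal{T}}(f,F,L,k)=\sup\left\{\int_K[\max(\mathcal{M}_{\mathcal{T}}\phi,L)]^p\,d\mu:\ \phi\ge 0\text{ measurable},\ \int_X\phi\,d\mu=f,\ \int_X\phi^p\,d\mu=F,\ K\subseteq X\text{ measurable},\ \mu(K)=k\right\},$$ and the function of three variables is $B_p^{\mathcal{T}}(f,F,k)=B_p^{\mathcal{T}}(f,F,f,k)$ (the case $L=f$). *)

theory Defs
  imports "HOL-Probability.Probability"
begin

definition nonatomic :: "'a measure \<Rightarrow> bool" where
  "nonatomic M \<longleftrightarrow>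
     (\<forall>A\<in>sets M. 0 < emeasure M A \<longrightarrow>
        (\<exists>B\<in>sets M. B \<subseteq> A \<and> 0 < emeasure M B \<and> emeasure M B < emeasure M A))"

primrec tree_level :: "'a measure \<Rightarrow> ('a set \<Rightarrow> 'a set set) \<Rightarrow> nat \<Rightarrow> 'a set set" where
  "tree_level M C 0 = {space M}"
| "tree_level M C (Suc m) = (\<Union>I\<in>tree_level M C m. C I)"

(* The limit over x \<in> I \<in> T with \<mu>(I) \<rightarrow> 0 is taken along the filter on sets I generated by the
   families {I \<in> T. x \<in> I \<and> 0 < \<mu>(I) < \<delta>}, \<delta> > 0. *)
definition differentiates_L1 :: "'a measure \<Rightarrow> 'a set set \<Rightarrow> bool" where
  "differentiates_L1 M T \<longleftrightarrow>
     (\<forall>\<phi> :: 'a \<Rightarrow> real. integrable M \<phi> \<longrightarrow>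
        (AE x in M.
           ((\<lambda>I. (LINT y:I|M. \<phi> y) / measure M I) \<longlongrightarrow> \<phi> x)
             (inf (filtercomap (measure M) (at_right 0)) (principal {I \<in> T. x \<in> I}))))"

definition is_tree :: "'a measure \<Rightarrow> 'a set set \<Rightarrow> bool" where
  "is_tree M T \<longleftrightarrow>
     T \<subseteq> sets M \<and>
     space M \<in> T \<and>
     (\<forall>I\<in>T. 0 < emeasure M I) \<and>
     (\<exists>C. (\<forall>I\<in>T. C I \<subseteq> T \<and> countable (C I) \<and> (\<exists>A\<in>C I. \<exists>B\<in>C I. A \<noteq> B) \<and>
                  disjoint (C I) \<and> I = \<Union>(C I)) \<and>
          T = (\<Union>m. tree_level M C m) \<and>
          (\<lambda>m. SUP I\<in>tree_level M C m. emeasure M I) \<longlonglongrightarrow> 0) \<and>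
     differentiates_L1 M T"

definition tree_maximal :: "'a measure \<Rightarrow> 'a set set \<Rightarrow> ('a \<Rightarrow> real) \<Rightarrow> 'a \<Rightarrow> ennreal" where
  "tree_maximal M T \<phi> x =
     (SUP I\<in>{I \<in> T. x \<in> I}. (\<integral>\<^sup>+y\<in>I. ennreal \<bar>\<phi> y\<bar> \<partial>M) / emeasure M I)"

(* Real power on [0,\<infinity>], meant for exponents p > 0. *)
definition ennpowr :: "ennreal \<Rightarrow> real \<Rightarrow> ennreal" where
  "ennpowr a p = (if a = top then top else ennreal (enn2real a powr p))"

definition bellman4 ::
  "'a measure \<Rightarrow> 'a set set \<Rightarrow> real \<Rightarrow> real \<Rightarrow> real \<Rightarrow> real \<Rightarrow> real \<Rightarrow> ennreal" where
  "bellman4 M T p f F L k =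
     Sup {(\<integral>\<^sup>+x\<in>K. ennpowr (max (tree_maximal M T \<phi> x) (ennreal L)) p \<partial>M) | \<phi> K.
            \<phi> \<in> borel_measurable M \<and> (\<forall>x\<in>space M. 0 \<le> \<phi> x) \<and>
            (\<integral>\<^sup>+x. ennreal (\<phi> x) \<partial>M) = ennreal f \<and>
            (\<integral>\<^sup>+x. ennreal (\<phi> x powr p) \<partial>M) = ennreal F \<and>
            K \<in> sets M \<and> emeasure M K = ennreal k}"

definition bellman3 ::
  "'a measure \<Rightarrow> 'a set set \<Rightarrow> real \<Rightarrow> real \<Rightarrow> real \<Rightarrow> real \<Rightarrow> ennreal" where
  "bellman3 M T p f F k = bellman4 M T p f F f k"

end

theory Submission
  imports Defs
begin

text \<open>Given \<open>\<phi>\<close> and \<open>K\<close>, split \<open>K\<close> into the part where the maximal function exceeds \<open>L\<close>, of measure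
  \<open>k1\<close>, and the rest, where the integrand is the constant \<open>L powr p\<close>; when \<open>k1 = 0\<close>, which the
  supremum excludes, let \<open>k1\<close> tend to \<open>0\<close>. Conversely, a competitor for \<open>k1\<close> extends, since \<open>M\<close> has
  no atoms, to one for \<open>k\<close>, by adjoining a set of measure \<open>k - k1\<close> on which the integrand is at
  least \<open>L powr p\<close>. A competitor must exist for this (the supremum of the empty set is \<open>0\<close>).\<close>

section \<open>Measurability of the maximal function and of real powers\<close>

lemma countable_tree_level:
  assumes "\<And>I. I \<in> (\<Union>m. tree_level M C m) \<Longrightarrow> countable (C I)"
  shows "countable (tree_level M C m)"
proof (induction m)
  case (Suc m)
  then show ?case
    unfolding tree_level.simps by (rule countable_UN) (use assms in blast)
qed simp

lemma countable_tree:
  assumes "is_tree M T"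
  shows "countable T"
proof -
  obtain C where C: "\<forall>I\<in>T. C I \<subseteq> T \<and> countable (C I) \<and> (\<exists>A\<in>C I. \<exists>B\<in>C I. A \<noteq> B) \<and>
                  disjoint (C I) \<and> I = \<Union>(C I)"
    and T: "T = (\<Union>m. tree_level M C m)"
    using assms unfolding is_tree_def by (elim conjE exE) (rule that)
  have "countable (C I)" if "I \<in> (\<Union>m. tree_level M C m)" for I
    using C that unfolding T[symmetric] by blast
  then have "countable (\<Union>m. tree_level M C m)"
    by (intro countable_UN countable_tree_level countableI_type)
  with T show ?thesis by (rule ssubst)
qed

text \<open>Since a tree is countable, the maximal function is a countable supremum of measurable
  functions. Measurability is what later lets the integral over \<open>K\<close> be split
  additively.\<close>

lemma borel_measurable_tree_maximal:
  assumes "is_tree M T" and [measurable]: "\<phi> \<in> borel_measurable M"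
  shows "tree_maximal M T \<phi> \<in> borel_measurable M"
proof -
  define c where "c I = (\<integral>\<^sup>+y\<in>I. ennreal \<bar>\<phi> y\<bar> \<partial>M) / emeasure M I" for I
  \<comment> \<open>The indicator makes the index set independent of \<open>x\<close>: a set not
    containing \<open>x\<close> contributes 0, the least element of \<open>ennreal\<close>, and
    leaves the supremum unchanged.\<close>
  have "tree_maximal M T \<phi> x = (SUP I\<in>T. c I * indicator I x)" for x
    unfolding tree_maximal_def c_def[symmetric]
  proof (rule antisym)
    show "(SUP I\<in>{I \<in> T. x \<in> I}. c I) \<le> (SUP I\<in>T. c I * indicator I x)"
      by (rule SUP_least) (auto intro!: SUP_upper2)
    show "(SUP I\<in>T. c I * indicator I x) \<le> (SUP I\<in>{I \<in> T. x \<in> I}. c I)"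
      by (rule SUP_least) (auto simp: indicator_def intro!: SUP_upper2)
  qed
  then have eq: "tree_maximal M T \<phi> = (\<lambda>x. SUP I\<in>T. c I * indicator I x)" by auto
  have [measurable]: "I \<in> sets M" if "I \<in> T" for I
    using assms that unfolding is_tree_def by auto
  show ?thesis unfolding eq
    by (rule borel_measurable_SUP[OF countable_tree[OF assms(1)]]) measurable
qed

lemma borel_measurable_ennpowr [measurable]:
  "(\<lambda>a. ennpowr a p) \<in> borel_measurable borel"
proof -
  have "Measurable.pred borel (\<lambda>a::ennreal. a = top)"
    by (simp add: pred_def)
  then show ?thesis
    unfolding ennpowr_def by (intro measurable_If) (auto simp: pred_def)
qed

lemma ennpowr_mono:
  assumes "a \<le> b" "0 \<le> p"
  shows "ennpowr a p \<le> ennpowr b p"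
proof (cases "b = top")
  case False
  \<comment> \<open>As \<open>enn2real top\<close> is 0, \<open>enn2real\<close> is monotone only
    below \<open>top\<close>, so finiteness is settled first.\<close>
  then have "b < top" by (simp add: less_top)
  moreover from this assms have "a < top" by (auto intro: le_less_trans)
  ultimately have "ennreal (enn2real a powr p) \<le> ennreal (enn2real b powr p)"
    using assms by (intro ennreal_leI powr_mono2 enn2real_mono) auto
  with \<open>a < top\<close> \<open>b < top\<close> show ?thesis by (auto simp: ennpowr_def)
qed (simp add: ennpowr_def)

section \<open>Sets of prescribed measure in a non-atomic space\<close>

context finite_measure
begin

text \<open>Of a proper piece \<open>B\<close> and its complement \<open>A - B\<close>, both of
  positive measure, one has at most half the measure of \<open>A\<close>.\<close>

lemma nonatomic_halving:
  assumes "nonatomic M" "A \<in> sets M" "0 < measure M A"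
  shows "\<exists>B\<in>sets M. B \<subseteq> A \<and> 0 < measure M B \<and> measure M B \<le> measure M A / 2"
proof -
  have "0 < emeasure M A" using assms(3) by (simp add: emeasure_eq_measure)
  with assms obtain B where "B \<in> sets M" "B \<subseteq> A" "0 < emeasure M B" "emeasure M B < emeasure M A"
    unfolding nonatomic_def by blast
  then have B: "B \<in> sets M" "B \<subseteq> A" "0 < measure M B" "measure M B < measure M A"
    by (simp_all add: emeasure_eq_measure ennreal_less_iff)
  show ?thesis
  proof (cases "measure M B \<le> measure M A / 2")
    case False
    with B assms(2) show ?thesis
      by (intro bexI[of _ "A - B"]) (auto simp: finite_measure_Diff)
  qed (use B in blast)
qed

text \<open>Halving \<open>n\<close> times leaves positive measure at most
  \<open>measure M A / 2 ^ n\<close>, which is at most \<open>e\<close> for large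
  \<open>n\<close>.\<close>

lemma nonatomic_small_subset:
  assumes "nonatomic M" "A \<in> sets M" "0 < measure M A" "0 < e"
  shows "\<exists>B\<in>sets M. B \<subseteq> A \<and> 0 < measure M B \<and> measure M B \<le> e"
proof -
  have iter: "\<exists>B\<in>sets M. B \<subseteq> A \<and> 0 < measure M B \<and> measure M B \<le> measure M A / 2 ^ n" for n
  proof (induction n)
    case (Suc n)
    then obtain B where B: "B \<in> sets M" "B \<subseteq> A" "0 < measure M B" "measure M B \<le> measure M A / 2 ^ n"
      by blast
    obtain D where "D \<in> sets M" "D \<subseteq> B" "0 < measure M D" "measure M D \<le> measure M B / 2"
      using nonatomic_halving[OF assms(1) B(1,3)] by blast
    moreover from this B have "measure M D \<le> measure M A / 2 ^ Suc n"
      by simp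
    ultimately show ?case using B by blast
  qed (use assms in auto)
  obtain n where "measure M A / e < 2 ^ n"
    using real_arch_pow[of 2 "measure M A / e"] by auto
  then have "measure M A / 2 ^ n \<le> e"
    using assms(4) by (simp add: field_simps)
  with iter[of n] show ?thesis by (meson order_trans)
qed

text \<open>Sierpinski's theorem, by exhaustion: each step adds a set of at least half the largest
  measure that still fits under \<open>t\<close>. If the union fell short of \<open>t\<close>, a small set disjoint from
  it would fit at every step, so the increments could not be summable.\<close>

lemma nonatomic_subset_of_measure:
  assumes na: "nonatomic M" and A: "A \<in> sets M" and t: "0 \<le> t" "t \<le> measure M A"
  shows "\<exists>B\<in>sets M. B \<subseteq> A \<and> measure M B = t"
proof -
  define S where "S B = {D \<in> sets M. D \<subseteq> A - B \<and> measure M B + measure M D \<le> t}" for B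
  define \<sigma> where "\<sigma> B = Sup (measure M ` S B)" for B
  define P where "P B \<longleftrightarrow> B \<in> sets M \<and> B \<subseteq> A \<and> measure M B \<le> t" for B
  have bdd: "bdd_above (measure M ` S B)" for B
    by (rule bdd_aboveI[of _ "measure M (space M)"]) (auto intro: bounded_measure)
  have step: "\<exists>D\<in>S B. \<sigma> B / 2 \<le> measure M D" if "P B" for B
  proof -
    have ne: "{} \<in> S B" using that by (auto simp: S_def P_def)
    show ?thesis
    \<comment> \<open>For positive \<open>\<sigma> B\<close>, half of it lies strictly below the
      supremum and is exceeded by some member of \<open>S B\<close>; otherwise the empty set
      suffices.\<close>
    proof (cases "\<sigma> B > 0")
      case True
      then have "\<sigma> B / 2 < Sup (measure M ` S B)" unfolding \<sigma>_def by simp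
      then obtain D where "D \<in> S B" "\<sigma> B / 2 < measure M D"
        using less_cSup_iff[OF _ bdd] ne by blast
      then show ?thesis by force
    next
      case False
      with ne show ?thesis by (intro bexI[of _ "{}"]) auto
    qed
  qed
  have "\<exists>B. \<forall>n. P (B n) \<and> B n \<subseteq> B (Suc n) \<and> measure M (B n) + \<sigma> (B n) / 2 \<le> measure M (B (Suc n))"
  proof (rule dependent_nat_choice)
    show "\<exists>B. P B" using t by (auto simp: P_def intro!: exI[of _ "{}"])
    fix B :: "'a set" and n :: nat assume PB: "P B"
    then obtain D where D: "D \<in> S B" "\<sigma> B / 2 \<le> measure M D" using step by blast
    have "measure M (B \<union> D) = measure M B + measure M D"
      using D PB by (intro finite_measure_Union) (auto simp: S_def P_def)
    with D PB show "\<exists>B'. P B' \<and> B \<subseteq> B' \<and> measure M B + \<sigma> B / 2 \<le> measure M B'"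
      by (intro exI[of _ "B \<union> D"]) (auto simp: S_def P_def)
  qed
  then obtain B where B: "\<And>n. P (B n)" "\<And>n. B n \<subseteq> B (Suc n)"
      "\<And>n. measure M (B n) + \<sigma> (B n) / 2 \<le> measure M (B (Suc n))"
    by blast
  define U where "U = (\<Union>n. B n)"
  have lim: "(\<lambda>n. measure M (B n)) \<longlonglongrightarrow> measure M U"
    unfolding U_def using B by (intro finite_Lim_measure_incseq) (auto simp: P_def incseq_Suc_iff)
  have U: "U \<in> sets M" "U \<subseteq> A" using B by (auto simp: U_def P_def)
  have le: "measure M U \<le> t"
    using lim by (rule LIMSEQ_le_const2) (use B in \<open>auto simp: P_def\<close>)
  have "measure M U = t"
  proof (rule ccontr)
    assume "measure M U \<noteq> t"
    with le have lt: "measure M U < t" by simp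
    with t U A have "0 < measure M (A - U)" by (simp add: finite_measure_Diff)
    then obtain D where D: "D \<in> sets M" "D \<subseteq> A - U" "0 < measure M D" "measure M D \<le> t - measure M U"
      using nonatomic_small_subset[OF na, of "A - U" "t - measure M U"] lt U A by auto
    \<comment> \<open>The same \<open>D\<close> is a candidate at every stage: it avoids
      \<open>U\<close>, which contains \<open>B n\<close>, and
      \<open>measure M (B n) \<le> measure M U\<close> leaves room for it below
      \<open>t\<close>.\<close>
    have incr: "measure M (B n) + measure M D / 2 \<le> measure M (B (Suc n))" for n
    proof -
      have "measure M (B n) \<le> measure M U"
        using U by (intro finite_measure_mono) (auto simp: U_def)
      with D have "D \<in> S (B n)" by (auto simp: S_def U_def)
      then have "measure M D \<le> \<sigma> (B n)" unfolding \<sigma>_def by (intro cSup_upper bdd) auto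
      with B(3)[of n] show ?thesis by simp
    qed
    \<comment> \<open>Both sides of \<open>incr\<close> are passed to the limit.\<close>
    have "measure M U + measure M D / 2 \<le> measure M U"
      by (rule LIMSEQ_le[OF tendsto_add[OF lim tendsto_const] LIMSEQ_Suc[OF lim]]) (use incr in auto)
    with D show False by simp
  qed
  with U show ?thesis by blast
qed

end

text \<open>A multiple of the indicator of a set of measure \<open>a\<close> has mean \<open>f\<close> and \<open>p\<close>-th moment
  \<open>f powr p * a powr (1 - p)\<close>, which equals \<open>F\<close> for \<open>a = (f powr p / F) powr (1 / (p - 1))\<close>.\<close>

lemma (in prob_space) nonatomic_function_with_moments:
  fixes p f F :: real
  assumes "nonatomic M" "p > 1" "0 < f" "f powr p \<le> F"
  shows "\<exists>\<phi>\<in>borel_measurable M. (\<forall>x\<in>space M. 0 \<le> \<phi> x) \<and>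
           (\<integral>\<^sup>+x. ennreal (\<phi> x) \<partial>M) = ennreal f \<and>
           (\<integral>\<^sup>+x. ennreal (\<phi> x powr p) \<partial>M) = ennreal F"
proof -
  define a where "a = (f powr p / F) powr (1 / (p - 1))"
  have "0 < f powr p" using assms by simp
  with assms have F: "F > 0" by linarith
  \<comment> \<open>The bound \<open>a \<le> 1\<close> comes from \<open>f powr p \<le> F\<close>
    and lets a set of measure \<open>a\<close> fit into the probability space.\<close>
  have a: "0 < a" "a \<le> 1"
    using assms F by (auto simp: a_def intro!: powr_le1)
  have ap: "a powr (p - 1) = f powr p / F"
    using assms F by (simp add: a_def powr_powr)
  then have "a powr p = a * (f powr p / F)"
    using a powr_add[of a 1 "p - 1"] by simp
  then have eqF: "(f / a) powr p * a = F"
    using assms F a by (simp add: powr_divide)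
  obtain A where A [measurable]: "A \<in> sets M" and mA: "measure M A = a"
    using nonatomic_subset_of_measure[of "space M" a] assms(1) a prob_space by auto
  have eA: "emeasure M A = ennreal a" by (simp add: emeasure_eq_measure mA)
  define \<phi> where "\<phi> x = f / a * indicator A x" for x
  have "(\<integral>\<^sup>+x. ennreal (\<phi> x) \<partial>M) = (\<integral>\<^sup>+x. ennreal (f / a) * indicator A x \<partial>M)"
    by (intro nn_integral_cong) (auto simp: \<phi>_def indicator_def)
  also have "\<dots> = ennreal (f / a) * ennreal a"
    by (simp add: nn_integral_cmult_indicator eA)
  also have "\<dots> = ennreal f" using a assms by (simp flip: ennreal_mult)
  finally have 1: "(\<integral>\<^sup>+x. ennreal (\<phi> x) \<partial>M) = ennreal f" .
  have "(\<integral>\<^sup>+x. ennreal (\<phi> x powr p) \<partial>M) = (\<integral>\<^sup>+x. ennreal ((f / a) powr p) * indicator A x \<partial>M)"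
    using assms by (intro nn_integral_cong) (auto simp: \<phi>_def indicator_def)
  also have "\<dots> = ennreal ((f / a) powr p) * ennreal a"
    by (simp add: nn_integral_cmult_indicator eA)
  also have "\<dots> = ennreal F" using a assms eqF by (simp flip: ennreal_mult)
  finally have 2: "(\<integral>\<^sup>+x. ennreal (\<phi> x powr p) \<partial>M) = ennreal F" .
  have "\<phi> \<in> borel_measurable M" "\<forall>x\<in>space M. 0 \<le> \<phi> x"
    using a assms by (auto simp: \<phi>_def [abs_def])
  with 1 2 show ?thesis by blast
qed

section \<open>Set integrals against constants\<close>

lemma set_nn_integral_const_cong:
  assumes "A \<in> sets M" "\<And>x. x \<in> A \<Longrightarrow> g x = c"
  shows "(\<integral>\<^sup>+x\<in>A. g x \<partial>M) = c * emeasure M A"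
proof -
  have "(\<integral>\<^sup>+x\<in>A. g x \<partial>M) = (\<integral>\<^sup>+x. c * indicator A x \<partial>M)"
    using assms by (intro nn_integral_cong) (auto simp: indicator_def)
  with assms show ?thesis by (simp add: nn_integral_cmult_indicator)
qed

lemma set_nn_integral_ge_const:
  assumes "A \<in> sets M" "\<And>x. x \<in> A \<Longrightarrow> c \<le> g x"
  shows "c * emeasure M A \<le> (\<integral>\<^sup>+x\<in>A. g x \<partial>M)"
proof -
  have "c * emeasure M A = (\<integral>\<^sup>+x. c * indicator A x \<partial>M)"
    using assms by (simp add: nn_integral_cmult_indicator)
  also have "\<dots> \<le> (\<integral>\<^sup>+x\<in>A. g x \<partial>M)"
    using assms by (intro nn_integral_mono) (auto simp: indicator_def)
  finally show ?thesis .
qed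

section \<open>Splitting and enlarging the set of integration\<close>

theorem theorem5p1:
  fixes M :: "'a measure" and T :: "'a set set" and p f F L k :: real
  assumes "prob_space M" and "nonatomic M" and "is_tree M T"
    and "p > 1" and "0 < f" and "f powr p \<le> F" and "f \<le> L" and "0 < k" and "k \<le> 1"
  shows "bellman4 M T p f F L k =
           (SUP k1\<in>{0<..k}. bellman3 M T p f F k1 + ennreal (L powr p * (k - k1)))"
proof -
  interpret prob_space M by fact
  define adm where "adm \<phi> \<longleftrightarrow> \<phi> \<in> borel_measurable M \<and> (\<forall>x\<in>space M. 0 \<le> \<phi> x) \<and>
      (\<integral>\<^sup>+x. ennreal (\<phi> x) \<partial>M) = ennreal f \<and>
      (\<integral>\<^sup>+x. ennreal (\<phi> x powr p) \<partial>M) = ennreal F" for \<phi>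
  define g where "g l \<phi> x = ennpowr (max (tree_maximal M T \<phi> x) (ennreal l)) p" for l \<phi> x
  \<comment> \<open>The Bellman functions of four and three variables are \<open>Sup (V l k)\<close>
    with \<open>l = L\<close> and \<open>l = f\<close>; they differ only in the cut-off inside
    \<open>g\<close>.\<close>
  define V where "V l k = {(\<integral>\<^sup>+x\<in>K. g l \<phi> x \<partial>M) | \<phi> K. adm \<phi> \<and> K \<in> sets M \<and> emeasure M K = ennreal k}"
    for l k
  have bellman: "bellman4 M T p f F l k = Sup (V l k)" for l k
    unfolding bellman4_def V_def g_def adm_def by (simp add: conj_assoc)
  have L: "0 < L" using assms by linarith
  have meas: "g l \<phi> \<in> borel_measurable M" if "adm \<phi>" for l \<phi>
  proof -
    have [measurable]: "tree_maximal M T \<phi> \<in> borel_measurable M"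
      using borel_measurable_tree_maximal assms(3) that by (auto simp: adm_def)
    show ?thesis unfolding g_def by measurable
  qed
  have g_L: "ennreal (L powr p) \<le> g L \<phi> x" for \<phi> x
  proof -
    have "ennreal (L powr p) = ennpowr (ennreal L) p" using L by (simp add: ennpowr_def)
    also have "\<dots> \<le> g L \<phi> x" unfolding g_def using assms(4) by (intro ennpowr_mono) auto
    finally show ?thesis .
  qed
  have g_mono: "g f \<phi> x \<le> g L \<phi> x" for \<phi> x
    unfolding g_def using assms by (intro ennpowr_mono max.mono ennreal_leI) auto
  have split: "(\<integral>\<^sup>+x\<in>K. h x \<partial>M) = (\<integral>\<^sup>+x\<in>A. h x \<partial>M) + (\<integral>\<^sup>+x\<in>K - A. h x \<partial>M)"
    if "h \<in> borel_measurable M" "A \<in> sets M" "K \<in> sets M" "A \<subseteq> K" for h :: "'a \<Rightarrow> ennreal" and A K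
  proof -
    have "K = A \<union> (K - A)" using that by auto
    with that show ?thesis using nn_integral_disjoint_pair[of h M A "K - A"] by auto
  qed
  have le: "Sup (V L k) \<le> (SUP k1\<in>{0<..k}. Sup (V f k1) + ennreal (L powr p * (k - k1)))" (is "_ \<le> ?R")
  proof (rule Sup_least)
    fix v assume "v \<in> V L k"
    then obtain \<phi> K where adm: "adm \<phi>" and K [measurable]: "K \<in> sets M"
      and eK: "emeasure M K = ennreal k" and v: "v = (\<integral>\<^sup>+x\<in>K. g L \<phi> x \<partial>M)"
      unfolding V_def by blast
    have [measurable]: "tree_maximal M T \<phi> \<in> borel_measurable M"
      using borel_measurable_tree_maximal assms(3) adm by (auto simp: adm_def)
    \<comment> \<open>On \<open>A\<close> the maximal function exceeds both cut-offs, so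
      \<open>g L\<close> and \<open>g f\<close> agree there; on \<open>K - A\<close> the maximum is
      exactly \<open>L\<close>.\<close>
    define A where "A = K \<inter> {x \<in> space M. ennreal L < tree_maximal M T \<phi> x}"
    have A [measurable]: "A \<in> sets M" and AK: "A \<subseteq> K" unfolding A_def by auto
    define k1 where "k1 = measure M A"
    have mK: "measure M K = k" using eK assms(8) by (simp add: emeasure_eq_measure)
    have k1: "0 \<le> k1" "k1 \<le> k"
      using finite_measure_mono[OF AK K] by (auto simp: k1_def mK)
    have eD: "emeasure M (K - A) = ennreal (k - k1)"
      using AK by (simp add: emeasure_eq_measure finite_measure_Diff mK k1_def)
    have "g L \<phi> x = ennreal (L powr p)" if "x \<in> K - A" for x
    proof -
      have "x \<in> space M" using that sets.sets_into_space[OF K] by auto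
      with that have "max (tree_maximal M T \<phi> x) (ennreal L) = ennreal L"
        by (auto simp: A_def max_def not_less)
      with L show ?thesis by (simp add: g_def ennpowr_def)
    qed
    then have D: "(\<integral>\<^sup>+x\<in>K - A. g L \<phi> x \<partial>M) = ennreal (L powr p * (k - k1))"
      using k1 by (subst set_nn_integral_const_cong[where c="ennreal (L powr p)"])
        (auto simp: eD ennreal_mult)
    have gA: "g L \<phi> x = g f \<phi> x" if "x \<in> A" for x
    proof -
      have "ennreal L < tree_maximal M T \<phi> x" using that by (simp add: A_def)
      moreover have "ennreal f \<le> ennreal L" using assms by (simp add: ennreal_leI)
      ultimately show ?thesis by (simp add: g_def max_absorb1 less_imp_le order_trans[of "ennreal f" "ennreal L"])
    qed
    have v': "v = (\<integral>\<^sup>+x\<in>A. g f \<phi> x \<partial>M) + ennreal (L powr p * (k - k1))"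
      unfolding v split[OF meas[OF adm] A K AK] D
      by (intro arg_cong2[where f="(+)"] nn_integral_cong refl) (auto simp: gA indicator_def)
    show "v \<le> ?R"
    proof (cases "k1 = 0")
      case False
      have "(\<integral>\<^sup>+x\<in>A. g f \<phi> x \<partial>M) \<in> V f k1"
        unfolding V_def mem_Collect_eq using adm A
        by (intro exI[of _ \<phi>] exI[of _ A]) (simp add: k1_def emeasure_eq_measure)
      then have "v \<le> Sup (V f k1) + ennreal (L powr p * (k - k1))"
        unfolding v' by (intro add_mono Sup_upper) auto
      then show ?thesis using False k1 by (intro SUP_upper2[of k1]) auto
    next
      case True
      then have "A \<in> null_sets M" by (auto simp: k1_def emeasure_eq_measure)
      then have "(\<integral>\<^sup>+x\<in>A. g f \<phi> x \<partial>M) = 0"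
        by (rule nn_integral_null_set)
      then have v0: "v = ennreal (L powr p * k)" using v' True by simp
      \<comment> \<open>For each \<open>s\<close> in \<open>{0<..<k}\<close>, dropping the
        nonnegative term \<open>Sup (V f s)\<close> shows that
        \<open>ennreal (L powr p * (k - s))\<close> is at most \<open>?R\<close>; the bound survives
        the limit, which is \<open>v\<close>.\<close>
      have "((\<lambda>s. ennreal (L powr p * (k - s))) \<longlongrightarrow> ennreal (L powr p * (k - 0))) (at_right 0)"
        by (intro tendsto_intros)
      moreover have "eventually (\<lambda>s. ennreal (L powr p * (k - s)) \<le> ?R) (at_right 0)"
      proof -
        have "eventually (\<lambda>s::real. s \<in> {0<..<k}) (at_right 0)"
          using assms(8) by (rule eventually_at_right_real)
        then show ?thesis
          by eventually_elim (rule SUP_upper2, auto)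
      qed
      ultimately show ?thesis
        unfolding v0 by (intro tendsto_upperbound[where F="at_right 0"]) auto
    qed
  qed
  have ge: "(SUP k1\<in>{0<..k}. Sup (V f k1) + ennreal (L powr p * (k - k1))) \<le> Sup (V L k)"
  proof (rule SUP_least)
    fix k1 assume "k1 \<in> {0<..k}"
    then have k1: "0 < k1" "k1 \<le> k" by auto
    \<comment> \<open>Adding a constant commutes with a supremum in \<open>ennreal\<close> only over
      a nonempty set.\<close>
    have ne: "V f k1 \<noteq> {}"
    proof -
      obtain \<phi> where "adm \<phi>"
        using nonatomic_function_with_moments[of p f F] assms unfolding adm_def by blast
      moreover obtain K where "K \<in> sets M" "measure M K = k1"
        using nonatomic_subset_of_measure[of "space M" k1] assms k1 prob_space by auto
      ultimately show ?thesis unfolding V_def by (auto simp: emeasure_eq_measure)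
    qed
    have "v + ennreal (L powr p * (k - k1)) \<le> Sup (V L k)" if v: "v \<in> V f k1" for v
    proof -
      obtain \<phi> A where adm: "adm \<phi>" and A: "A \<in> sets M"
        and eA: "emeasure M A = ennreal k1" and v: "v = (\<integral>\<^sup>+x\<in>A. g f \<phi> x \<partial>M)"
        using v unfolding V_def by blast
      have mA: "measure M A = k1" using eA k1 by (simp add: emeasure_eq_measure)
      \<comment> \<open>There is room for \<open>D\<close> because \<open>space M - A\<close> has
        measure \<open>1 - k1\<close>, and \<open>k \<le> 1\<close>. Its position is irrelevant, as
        \<open>g_L\<close> bounds the integrand from below everywhere.\<close>
      obtain D where D: "D \<in> sets M" "D \<subseteq> space M - A" "measure M D = k - k1"
        using nonatomic_subset_of_measure[of "space M - A" "k - k1"] assms(2,9) k1 A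
        by (auto simp: prob_compl mA)
      define K where "K = A \<union> D"
      have KA: "K - A = D" and K: "K \<in> sets M" "A \<subseteq> K" using A D by (auto simp: K_def)
      have "measure M K = k"
        unfolding K_def using A D mA by (subst finite_measure_Union) auto
      then have eK: "emeasure M K = ennreal k" by (simp add: emeasure_eq_measure)
      have "ennreal (L powr p * (k - k1)) = ennreal (L powr p) * emeasure M D"
        using k1 by (simp add: emeasure_eq_measure D ennreal_mult)
      also have "\<dots> \<le> (\<integral>\<^sup>+x\<in>D. g L \<phi> x \<partial>M)"
        by (rule set_nn_integral_ge_const[OF D(1) g_L])
      finally have "v + ennreal (L powr p * (k - k1)) \<le>
          (\<integral>\<^sup>+x\<in>A. g L \<phi> x \<partial>M) + (\<integral>\<^sup>+x\<in>D. g L \<phi> x \<partial>M)"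
        unfolding v by (intro add_mono nn_integral_mono mult_right_mono g_mono) auto
      also have "\<dots> = (\<integral>\<^sup>+x\<in>K. g L \<phi> x \<partial>M)"
        using split[OF meas[OF adm] A K] by (simp add: KA)
      also have "\<dots> \<le> Sup (V L k)"
        unfolding V_def using adm K eK by (intro Sup_upper) blast
      finally show ?thesis .
    qed
    then have "(SUP v\<in>V f k1. v + ennreal (L powr p * (k - k1))) \<le> Sup (V L k)"
      by (rule SUP_least)
    then show "Sup (V f k1) + ennreal (L powr p * (k - k1)) \<le> Sup (V L k)"
      using ennreal_SUP_add_left[OF ne, of "\<lambda>v. v" "ennreal (L powr p * (k - k1))"] by simp
  qed
  show ?thesis
    unfolding bellman3_def bellman using le ge by (rule antisym)
qed

end
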